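(* The following three statements (conjectured by Merca) are true, where in each of them $m$ ranges over the positive integers. (i) The congruence $$\sum_{k=-\infty}^{\infty} \sigma_{\mathrm{odd}}(n-P_m(k)) \equiv \begin{cases} n \pmod 2 & \text{if } n = P_m(j),\ j \in \mathbb{Z},\\ 0 \pmod 2 & \text{otherwise}\end{cases}$$ holds for all positive integers $n$ if and only if $m \in \{5,6\}$. (ii) The congruence $$\sum_{k=-\infty}^{\infty} \sigma_{\mathrm{odd}}(n-P_5(k)) \equiv \begin{cases} n \pmod m & \text{if } n = P_5(j),\ j \in \mathbb{Z},\\ 0 \pmod m & \text{otherwise}\end{cases}$$ holds for all positive integers $n$ if and only if $m \in \{2,3,6\}$. (iii) The congruence $$\sum_{k=-\infty}^{\infty} (-1)^{P_3(-k)}\sigma_{\mathrm{odd}}(n-P_5(k)) \equiv \begin{cases} (-1)^{P_3(-j)}\cdot n \pmod m & \text{if } n = P_5(j),\ j \in \mathbb{Z},\\ 0 \pmod m & \text{otherwise}\end{cases}$$ holds for all positive integers $n$ if and only if $m \in \{2,4\}$.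
   Context: For a positive integer $n$, $\sigma_{\mathrm{odd}}(n) := \sum_{d \mid n,\ d \text{ odd}} d$ is the sum of the odd positive divisors of $n$; for integers $n \le 0$, $\sigma_{\mathrm{odd}}(n) := 0$. For a positive integer $m$ and $k \in \mathbb{Z}$, the $k$th generalized $m$-gonal number is $$P_m(k) := \left(\frac{m}{2}-1\right)k^2 - \left(\frac{m}{2}-2\right)k.$$ In particular $P_3(k) = \frac{k^2+k}{2}$ and $P_5(k) = \frac{3k^2-k}{2}$. All sums run over all $k \in \mathbb{Z}$. For $m \ge 3$ only finitely many terms of $\sum_{k} \sigma_{\mathrm{odd}}(n-P_m(k))$ are nonzero. For $m \in \{1,2\}$ the sum in (i) diverges, and the congruence in (i) is then regarded as not holding.
   Formalization: In (ii) and (iii), m ranges over integers m ≥ 2 rather than all positive integers, because for m = 1 every congruence holds trivially although 1 is in neither {2,3,6} nor {2,4}; part (i) keeps all positive m. *)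

theory Defs
  imports "HOL-Analysis.Analysis" "HOL-Number_Theory.Cong"
begin

definition sigma_odd :: "int \<Rightarrow> int" where
  "sigma_odd n = (if n > 0 then \<Sum>d | d > 0 \<and> d dvd n \<and> odd d. d else 0)"

text \<open>
  The generalized polygonal number $(m/2 - 1) k^2 - (m/2 - 2) k$ is an integer; the numerator
  below is always even, so the division is exact (lemma \<open>of_int_gpolygonal\<close>).
\<close>

definition gpolygonal :: "nat \<Rightarrow> int \<Rightarrow> int" where
  "gpolygonal m k = ((int m - 2) * k\<^sup>2 - (int m - 4) * k) div 2"

lemma of_int_gpolygonal:
  "real_of_int (gpolygonal m k) =
     (real m / 2 - 1) * (real_of_int k)\<^sup>2 - (real m / 2 - 2) * real_of_int k"
proof -
  have "even ((int m - 2) * k\<^sup>2 - (int m - 4) * k)"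
    by auto
  then have "2 * gpolygonal m k = (int m - 2) * k\<^sup>2 - (int m - 4) * k"
    unfolding gpolygonal_def by simp
  then have "real_of_int (2 * gpolygonal m k) =
      real_of_int ((int m - 2) * k\<^sup>2 - (int m - 4) * k)"
    by (rule arg_cong)
  then show ?thesis
    by (simp add: field_simps)
qed

text \<open>
  Triangular numbers are nonnegative, so the conversion of the exponent to \<open>nat\<close> loses nothing.
\<close>

lemma gpolygonal_3_nonneg: "gpolygonal 3 k \<ge> 0"
proof -
  have "0 \<le> k * (k + 1)"
    by (cases "k \<ge> 0") (auto simp: zero_le_mult_iff)
  then show ?thesis
    by (simp add: gpolygonal_def power2_eq_square algebra_simps)
qed

definition tri_sign :: "int \<Rightarrow> int" where
  "tri_sign k = (- 1) ^ nat (gpolygonal 3 (- k))"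

text \<open>
  The sums over all integers are unordered sums in the discrete space \<open>int\<close>. There,
  \<open>f summable_on UNIV\<close> means that only finitely many terms are nonzero. As \<open>infsum\<close> is 0
  for a divergent sum, each congruence below explicitly includes summability: a congruence
  about a divergent sum does not hold (this matters for the first one when \<open>m\<close> is 1 or 2).
\<close>

definition gonal_cong :: "nat \<Rightarrow> int \<Rightarrow> bool" where
  "gonal_cong m n \<longleftrightarrow>
     (\<lambda>k. sigma_odd (n - gpolygonal m k)) summable_on UNIV \<and>
     [(\<Sum>\<^sub>\<infinity>k. sigma_odd (n - gpolygonal m k)) =
        (if \<exists>j. n = gpolygonal m j then n else 0)] (mod 2)"

definition pent_cong :: "nat \<Rightarrow> int \<Rightarrow> bool" where
  "pent_cong m n \<longleftrightarrow>
     (\<lambda>k. sigma_odd (n - gpolygonal 5 k)) summable_on UNIV \<and>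
     [(\<Sum>\<^sub>\<infinity>k. sigma_odd (n - gpolygonal 5 k)) =
        (if \<exists>j. n = gpolygonal 5 j then n else 0)] (mod int m)"

text \<open>
  Here the right-hand side depends on the index \<open>j\<close>, which is determined by \<open>n\<close>:
  \<open>gpolygonal 5\<close> is injective.
\<close>

lemma inj_gpolygonal_5: "inj (gpolygonal 5)"
proof (rule injI)
  fix j k :: int
  assume eq: "gpolygonal 5 j = gpolygonal 5 k"
  have even: "even (3 * x\<^sup>2 - x)" for x :: int
    by auto
  have "(3 * j\<^sup>2 - j) div 2 = (3 * k\<^sup>2 - k) div 2"
    using eq by (simp add: gpolygonal_def)
  then have "3 * j\<^sup>2 - j = 3 * k\<^sup>2 - k"
    using even[of j] even[of k] by (metis dvd_mult_div_cancel)
  then have "(j - k) * (3 * (j + k) - 1) = 0"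
    by (simp add: power2_eq_square algebra_simps)
  moreover have "3 * (j + k) - 1 \<noteq> 0"
    by presburger
  ultimately show "j = k"
    by simp
qed

definition signed_pent_cong :: "nat \<Rightarrow> int \<Rightarrow> bool" where
  "signed_pent_cong m n \<longleftrightarrow>
     (\<lambda>k. tri_sign k * sigma_odd (n - gpolygonal 5 k)) summable_on UNIV \<and>
     (\<forall>j. n = gpolygonal 5 j \<longrightarrow>
        [(\<Sum>\<^sub>\<infinity>k. tri_sign k * sigma_odd (n - gpolygonal 5 k)) = tri_sign j * n] (mod int m)) \<and>
     ((\<nexists>j. n = gpolygonal 5 j) \<longrightarrow>
        [(\<Sum>\<^sub>\<infinity>k. tri_sign k * sigma_odd (n - gpolygonal 5 k)) = 0] (mod int m))"

text \<open>
  For the last two congruences \<open>m\<close> is the modulus. Modulo 1 they hold trivially for every \<open>n\<close>,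
  so a classification of the moduli for which they hold has to start at \<open>m = 2\<close>.
\<close>

end

theory Submission
  imports Defs "HOL-Computational_Algebra.Formal_Power_Series"
begin

text \<open>
  By the Jacobi triple product, with $x = \pm 1$,
  $$\sum_j x^j q^{a j(j+1)/2 - bj} = \prod_{i \ge 1} (1 - q^{ai})(1 + x q^{ai-b})(1 + x q^{ai-(a-b)}),$$
  and the exponents are $P_5(j)$ for $(a,b) = (3,2)$ and $P_6(j)$ for $(a,b) = (4,3)$. Applying
  $q\,d/dq$ logarithmically gives a recurrence for the Lambert series of the product, whose
  $t$-th coefficient is a signed divisor sum of $t$. It is congruent to $\sigma_{odd}(t)$ modulo 6 for
  $(a,b,x) = (3,2,1)$ and modulo 2 for $(4,3,1)$, and for $(3,2,-1)$ it is $-\sigma(t)$,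
  which is $(-1)^t \sigma_{odd}(t)$ modulo 4. All other values of $m$ fail at some $n \le 3$.
  The product is handled as a formal power series truncated at $q^M$, starting from
  the $q$-binomial theorem.
\<close>

unbundle fps_syntax and no vec_syntax

subsection \<open>The finite Jacobi triple product\<close>

text \<open>The Gaussian binomial coefficient, given by the q-Pascal rule instead of a quotient, so
  that it makes sense in any commutative ring.\<close>

fun qbinom :: "'a::comm_ring_1 \<Rightarrow> nat \<Rightarrow> nat \<Rightarrow> 'a" where
  "qbinom q n 0 = 1"
| "qbinom q 0 (Suc k) = 0"
| "qbinom q (Suc n) (Suc k) = qbinom q n k + q ^ Suc k * qbinom q n (Suc k)"

text \<open>The q-Pochhammer symbol \<open>(q; q)_n\<close>.\<close>

definition qfact :: "'a::comm_ring_1 \<Rightarrow> nat \<Rightarrow> 'a" where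
  "qfact q n = (\<Prod>i<n. 1 - q ^ Suc i)"

lemma qfact_0 [simp]: "qfact q 0 = 1"
  and qfact_Suc [simp]: "qfact q (Suc n) = qfact q n * (1 - q ^ Suc n)"
  by (simp_all add: qfact_def)

lemma qbinom_eq_0: "n < k \<Longrightarrow> qbinom q n k = 0"
  by (induction q n k rule: qbinom.induct) auto

text \<open>Division-free product formula for Gaussian binomials. Nested induction on
  \<open>k\<close> and \<open>m\<close>: the q-Pascal rule reduces the step to (1 - q^(k+1)) +
  q^(k+1) (1 - q^(m+1)) = 1 - q^(k+m+2).\<close>

lemma qbinom_qfact: "qbinom q (k + m) k * qfact q k * qfact q m = qfact q (k + m)"
proof (induction k arbitrary: m)
  case 0
  show ?case by simp
next
  case (Suc k)
  note IH = Suc.IH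
  show ?case
  proof (induction m)
    case 0
    show ?case using IH[of 0] by (simp add: qbinom_eq_0 flip: mult.assoc)
  next
    case (Suc m)
    define A where "A = qfact q (Suc (k + m))"
    have 1: "qbinom q (k + Suc m) k * qfact q k * qfact q (Suc m) = A"
      using IH[of "Suc m"] by (simp add: A_def)
    have 2: "qbinom q (Suc (k + m)) (Suc k) * qfact q (Suc k) * qfact q m = A"
      using Suc.IH unfolding A_def add_Suc .
    have "qbinom q (Suc k + Suc m) (Suc k) * qfact q (Suc k) * qfact q (Suc m)
      = (qbinom q (k + Suc m) k * qfact q k * qfact q (Suc m)) * (1 - q ^ Suc k)
        + q ^ Suc k * (qbinom q (Suc (k + m)) (Suc k) * qfact q (Suc k) * qfact q m) * (1 - q ^ Suc m)"
      unfolding qfact_Suc add_Suc add_Suc_right qbinom.simps by (simp only: algebra_simps)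
    also have "\<dots> = A * (1 - q ^ (Suc k + Suc m))"
      unfolding 1 2 power_add by (simp only: algebra_simps mult_1_left)
    also have "\<dots> = qfact q (Suc k + Suc m)"
      by (simp add: A_def)
    finally show ?case .
  qed
qed

text \<open>Splitting off the factor with i = 0 turns the rest into the same product with
  \<open>w * q\<close> for \<open>w\<close>, hence the induction over arbitrary
  \<open>w\<close>.\<close>

lemma q_binomial_theorem:
  fixes q w y :: "'a::comm_ring_1"
  shows "(\<Prod>i<n. y + w * q ^ i) =
    (\<Sum>k\<le>n. q ^ (k choose 2) * qbinom q n k * w ^ k * y ^ (n - k))"
proof (induction n arbitrary: w)
  case 0
  show ?case by (simp add: numeral_2_eq_2)
next
  case (Suc n)
  define T where "T k = q ^ (k choose 2) * qbinom q n k * (w * q) ^ k * y ^ (n - k)" for k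
  define U where "U k = q ^ (k choose 2) * qbinom q n k * (w * q) ^ k * y ^ (Suc n - k)" for k
  have "(\<Prod>i<Suc n. y + w * q ^ i) = (y + w) * (\<Prod>i<n. y + (w * q) * q ^ i)"
    by (simp add: prod.lessThan_Suc_shift mult.assoc del: prod.lessThan_Suc)
  also have "\<dots> = (y + w) * (\<Sum>k\<le>n. T k)"
    unfolding Suc.IH T_def ..
  also have "\<dots> = (\<Sum>k\<le>n. y * T k) + (\<Sum>k\<le>n. w * T k)"
    by (simp add: distrib_right sum_distrib_left sum.distrib)
  \<comment> \<open>The added term \<open>U (Suc n)\<close> is zero because
    \<open>qbinom q n (Suc n)\<close> vanishes.\<close>
  also have "(\<Sum>k\<le>n. y * T k) = (\<Sum>k\<le>Suc n. U k)"
    by (simp add: T_def U_def qbinom_eq_0 Suc_diff_le mult_ac)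
  also have "\<dots> = y ^ Suc n + (\<Sum>k\<le>n. U (Suc k))"
    by (simp add: sum.atMost_Suc_shift U_def numeral_2_eq_2 del: sum.atMost_Suc)
  also have "\<dots> + (\<Sum>k\<le>n. w * T k) = y ^ Suc n + (\<Sum>k\<le>n. U (Suc k) + w * T k)"
    by (simp add: sum.distrib)
  \<comment> \<open>Both summands carry w^(k+1) y^(n-k); as (k choose 2) + k = (k+1 choose 2), they
    combine by the q-Pascal rule.\<close>
  also have "(\<Sum>k\<le>n. U (Suc k) + w * T k) = (\<Sum>k\<le>n. q ^ (Suc k choose 2) *
      qbinom q (Suc n) (Suc k) * w ^ Suc k * y ^ (Suc n - Suc k))"
    by (intro sum.cong)
      (simp_all add: T_def U_def numeral_2_eq_2 power_add power_mult_distrib algebra_simps)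
  also have "y ^ Suc n + \<dots> = (\<Sum>k\<le>Suc n. q ^ (k choose 2) *
      qbinom q (Suc n) k * w ^ k * y ^ (Suc n - k))"
    by (simp add: sum.atMost_Suc_shift numeral_2_eq_2 del: sum.atMost_Suc)
  finally show ?case .
qed

section \<open>Exponents of the theta series\<close>

definition theta_exp :: "nat \<Rightarrow> nat \<Rightarrow> int \<Rightarrow> int" where
  "theta_exp a b j = int a * (j * (j + 1) div 2) - int b * j"

lemma theta_exp_double: "2 * theta_exp a b j = int a * (j * (j + 1)) - 2 * int b * j"
proof -
  have "2 * (j * (j + 1) div 2) = j * (j + 1)" by simp
  then show ?thesis
    unfolding theta_exp_def by (metis mult.assoc mult.left_commute right_diff_distrib)
qed

text \<open>For j >= 0, j(j+1) >= 2j gives at least (a - b) j; for j < 0 the quadratic part is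
  nonnegative and -b j >= |j|. This growth makes every sum below finite and the outer terms
  negligible.\<close>

lemma theta_exp_ge_abs:
  assumes "0 < b" "b < a"
  shows "\<bar>j\<bar> \<le> theta_exp a b j"
proof (cases "0 \<le> j")
  case True
  have "int a * (2 * j) \<le> int a * (j * (j + 1))"
  proof (rule mult_left_mono)
    show "2 * j \<le> j * (j + 1)"
    proof (cases "j = 0")
      case False
      then have "j * 2 \<le> j * (j + 1)" using True by (intro mult_left_mono) auto
      then show ?thesis by simp
    qed simp
  qed simp
  moreover have "(int b + 1) * j \<le> int a * j"
    using True assms by (intro mult_right_mono) auto
  ultimately show ?thesis
    using theta_exp_double[of a b j] True by (simp add: algebra_simps)
next
  case False
  have "0 \<le> int a * (j * (j + 1))"
    using False by (intro mult_nonneg_nonneg mult_nonpos_nonpos) auto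
  moreover have "int b * j \<le> 1 * j"
    using False assms by (intro mult_right_mono_neg) auto
  ultimately show ?thesis
    using theta_exp_double[of a b j, unfolded mult.assoc] False by linarith
qed

lemma prod_lessThan_add:
  "(\<Prod>i<n + (m::nat). f i) = (\<Prod>i<n. f i) * (\<Prod>i<m. f (n + i) :: 'a::comm_monoid_mult)"
  by (induction m) (simp_all add: mult.assoc)

lemma prod_power_lessThan: "(\<Prod>i<n. q ^ i) = (q :: 'a::comm_monoid_mult) ^ (n choose 2)"
  by (induction n) (simp_all add: numeral_2_eq_2 power_add mult.commute)

text \<open>Term \<open>k\<close> of the q-binomial expansion has a fixed power of \<open>q\<close>,
  independent of \<open>k\<close>, times the theta power for the index n - k. Doubling clears the
  halves in the binomials.\<close>

lemma theta_exponent_shift: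
  assumes "0 < b" "b < a" "0 < n" "k \<le> 2 * n"
  shows "a * (k choose 2) + (a * n - b) * (2 * n - k) =
    a * (n choose 2) + (a * n - b) * n + nat (theta_exp a b (int n - int k))"
proof -
  have ch: "2 * int (i choose 2) = int i * (int i - 1)" for i
    by (induction i) (auto simp: numeral_2_eq_2 algebra_simps)
  have le: "b \<le> a * n" using assms by (metis One_nat_def Suc_leI less_imp_le_nat mult_le_mono nat_mult_1_right)
  have "0 \<le> theta_exp a b (int n - int k)"
    using theta_exp_ge_abs[OF assms(1,2), of "int n - int k"] by linarith
  then have nt: "int (nat (theta_exp a b (int n - int k))) = theta_exp a b (int n - int k)" by simp
  have "2 * int (a * (k choose 2) + (a * n - b) * (2 * n - k)) =
      int a * (2 * int (k choose 2)) + 2 * ((int a * int n - int b) * (2 * int n - int k))"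
    unfolding of_nat_add of_nat_mult of_nat_diff[OF le] of_nat_diff[OF assms(4)]
    by (simp add: algebra_simps)
  also have "\<dots> = int a * (2 * int (n choose 2)) + 2 * ((int a * int n - int b) * int n) +
      2 * theta_exp a b (int n - int k)"
    unfolding ch theta_exp_double by (simp add: algebra_simps)
  also have "\<dots> = 2 * int (a * (n choose 2) + (a * n - b) * n + nat (theta_exp a b (int n - int k)))"
    unfolding of_nat_add of_nat_mult of_nat_diff[OF le] nt by (simp add: algebra_simps)
  finally have "int (a * (k choose 2) + (a * n - b) * (2 * n - k)) =
      int (a * (n choose 2) + (a * n - b) * n + nat (theta_exp a b (int n - int k)))"
    by (simp only: mult_cancel_left) simp
  then show ?thesis by (simp only: of_nat_eq_iff)
qed

text \<open>
  Take the $q$-binomial theorem for $2n$ factors with base $q^a$, $w = x$ and $y = q^{an-b}$: the first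
  $n$ factors have a power of $q^a$ extracted, the others $y$. Term $k$ corresponds to the
  index $j = n - k$; evenness of $n$ makes $x^n = 1$, so that no sign remains.
\<close>

lemma finite_triple_product:
  fixes q x :: "'a::idom"
  assumes "0 < b" "b < a" "x * x = 1" "q \<noteq> 0" "even n"
  shows "(\<Prod>i<n. (1 + x * q ^ (a * Suc i - b)) * (1 + x * q ^ (a * i + b))) =
    (\<Sum>k\<le>2 * n. qbinom (q ^ a) (2 * n) k * x ^ k * q ^ nat (theta_exp a b (int n - int k)))"
    (is "?P = ?S")
proof (cases "n = 0")
  case True
  then show ?thesis by (simp add: theta_exp_def)
next
  case False
  define y where "y = q ^ (a * n - b)"
  define C where "C = (q ^ a) ^ (n choose 2) * y ^ n"
  have xn: "x ^ n = 1"
    using \<open>even n\<close> \<open>x * x = 1\<close> by (auto elim!: evenE simp: power_mult power2_eq_square)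
  have an: "b \<le> a * Suc i" for i using assms by simp
  \<comment> \<open>Reading the product backwards gives factor \<open>i\<close> the exponent
    \<open>a * Suc i - b\<close> once \<open>x * (q ^ a) ^ (n - Suc i)\<close> is extracted; x * x =
    1 lets \<open>x\<close> be pulled out of \<open>y\<close>.\<close>
  have "(\<Prod>i<n. y + x * (q ^ a) ^ i) = (\<Prod>i<n. y + x * (q ^ a) ^ (n - Suc i))"
    by (rule prod.nat_diff_reindex[symmetric])
  also have "\<dots> = (\<Prod>i<n. x * (q ^ a) ^ (n - Suc i) * (1 + x * q ^ (a * Suc i - b)))"
  proof (rule prod.cong[OF refl])
    fix i assume "i \<in> {..<n}"
    then have "a * n = a * (n - Suc i) + a * Suc i"
      by (metis Suc_leI add_mult_distrib2 le_add_diff_inverse2 lessThan_iff)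
    then have "a * n - b = a * (n - Suc i) + (a * Suc i - b)"
      using an[of i] by linarith
    then have "y = (q ^ a) ^ (n - Suc i) * q ^ (a * Suc i - b)"
      unfolding y_def by (simp add: power_add power_mult)
    moreover have "x * Q * (1 + x * r) = x * Q + (x * x) * Q * r" for Q r
      by (simp add: algebra_simps)
    ultimately show "y + x * (q ^ a) ^ (n - Suc i) = x * (q ^ a) ^ (n - Suc i) * (1 + x * q ^ (a * Suc i - b))"
      using \<open>x * x = 1\<close> by simp
  qed
  also have "\<dots> = x ^ n * (\<Prod>i<n. (q ^ a) ^ (n - Suc i)) * (\<Prod>i<n. 1 + x * q ^ (a * Suc i - b))"
    by (simp add: prod.distrib)
  also have "(\<Prod>i<n. (q ^ a) ^ (n - Suc i)) = (q ^ a) ^ (n choose 2)"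
    by (simp add: prod.nat_diff_reindex prod_power_lessThan)
  finally have 1: "(\<Prod>i<n. y + x * (q ^ a) ^ i) =
      (q ^ a) ^ (n choose 2) * (\<Prod>i<n. 1 + x * q ^ (a * Suc i - b))"
    using xn by simp
  \<comment> \<open>Here n > 0 matters: it keeps the natural subtraction \<open>a * n - b\<close>
    from truncating.\<close>
  have "b \<le> a * n" using an[of "n - 1"] False by simp
  then have "(q ^ a) ^ (n + i) = y * q ^ (a * i + b)" for i
    unfolding y_def by (simp add: algebra_simps flip: power_add power_mult)
  then have "y + x * (q ^ a) ^ (n + i) = y * (1 + x * q ^ (a * i + b))" for i
    by (simp add: algebra_simps)
  then have 2: "(\<Prod>i<n. y + x * (q ^ a) ^ (n + i)) = y ^ n * (\<Prod>i<n. 1 + x * q ^ (a * i + b))"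
    by (simp add: prod.distrib)
  have "C * ?P = (\<Prod>i<n + n. y + x * (q ^ a) ^ i)"
    unfolding prod_lessThan_add 1 2 C_def by (simp add: prod.distrib mult_ac)
  also have "\<dots> = (\<Sum>k\<le>2 * n. (q ^ a) ^ (k choose 2) * qbinom (q ^ a) (2 * n) k * x ^ k * y ^ (2 * n - k))"
    unfolding q_binomial_theorem mult_2 ..
  also have "\<dots> = (\<Sum>k\<le>2 * n. C * (qbinom (q ^ a) (2 * n) k * x ^ k * q ^ nat (theta_exp a b (int n - int k))))"
  proof (rule sum.cong[OF refl])
    fix k assume "k \<in> {..2 * n}"
    then have "(q ^ a) ^ (k choose 2) * y ^ (2 * n - k) = C * q ^ nat (theta_exp a b (int n - int k))"
      using theta_exponent_shift[of b a n k] assms False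
      unfolding C_def y_def by (simp flip: power_add power_mult)
    moreover have "u * v * w * t = c * (v * w * s)" if "u * t = c * s" for u v w t c s :: 'a
    proof -
      have "u * v * w * t = (u * t) * (v * w)" by (simp only: mult_ac)
      also have "\<dots> = c * (v * w * s)" unfolding that by (simp only: mult_ac)
      finally show ?thesis .
    qed
    ultimately show "(q ^ a) ^ (k choose 2) * qbinom (q ^ a) (2 * n) k * x ^ k * y ^ (2 * n - k) =
      C * (qbinom (q ^ a) (2 * n) k * x ^ k * q ^ nat (theta_exp a b (int n - int k)))"
      by blast
  qed
  also have "\<dots> = C * ?S"
    by (simp add: sum_distrib_left)
  \<comment> \<open>\<open>C\<close> is a power of \<open>q\<close>, hence nonzero in the integral
    domain, and cancels.\<close>
  finally show ?thesis
    using \<open>q \<noteq> 0\<close> by (simp add: C_def y_def)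
qed

subsection \<open>Logarithmic derivative of the triple product\<close>

text \<open>Divisibility by \<open>fps_X ^ M\<close> serves as congruence modulo q^M; a series with
  constant term 1 is a unit over any commutative ring.\<close>

lemma fps_X_power_dvd_cancel:
  fixes c g :: "'a::comm_ring_1 fps"
  assumes "fps_X ^ M dvd c * g" "c $ 0 = 1"
  shows "fps_X ^ M dvd g"
proof -
  have "fps_left_inverse c 1 * c = 1"
    using assms(2) by (intro fps_left_inverse) simp
  then have "g = fps_left_inverse c 1 * (c * g)"
    by (simp flip: mult.assoc)
  with assms(1) show ?thesis
    by (metis dvd_mult)
qed

lemma qfact_fps_X_nth_0:
  "0 < a \<Longrightarrow> qfact (fps_X ^ a :: 'a::comm_ring_1 fps) n $ 0 = 1"
  by (induction n) (simp_all flip: power_mult power_add power_Suc)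

text \<open>Every further factor is 1 - X^(a(n+1)) with a(n+1) >= M, which is 1 modulo X^M.\<close>

lemma qfact_fps_X_cong:
  assumes "0 < a" "M \<le> n"
  shows "fps_X ^ M dvd qfact (fps_X ^ a :: 'a::comm_ring_1 fps) n - qfact (fps_X ^ a) M"
  using assms(2)
proof (induction n rule: dec_induct)
  case (step n)
  have "M \<le> a * Suc n"
    using step.hyps assms(1) by (metis One_nat_def Suc_leI le_Suc_eq le_trans mult_le_mono nat_mult_1)
  then have "fps_X ^ M dvd (fps_X ^ a) ^ Suc n * qfact (fps_X ^ a :: 'a fps) n"
    by (simp add: le_imp_power_dvd flip: power_mult del: power_Suc)
  from dvd_diff[OF step.IH this] show ?case
    by (simp add: algebra_simps)
qed simp

text \<open>Modulo X^M all the q-factorials involved equal \<open>f M\<close>, so the product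
  formula becomes (f M)^2 B = f M, and the unit \<open>f M\<close> cancels. This is the truncated
  form of the limit 1/(q^a; q^a)_inf of central Gaussian binomials.\<close>

lemma qbinom_fps_X_cong:
  assumes "0 < a" "M \<le> k" "M \<le> m" "M \<le> N"
  shows "fps_X ^ M dvd qfact (fps_X ^ a :: 'a::comm_ring_1 fps) N * qbinom (fps_X ^ a) (k + m) k - 1"
proof -
  define f where "f = qfact (fps_X ^ a :: 'a fps)"
  define B where "B = qbinom (fps_X ^ a :: 'a fps) (k + m) k"
  have f: "fps_X ^ M dvd f n - f M" if "M \<le> n" for n
    unfolding f_def using assms(1) that by (rule qfact_fps_X_cong)
  have eq: "B * f k * f m = f (k + m)"
    unfolding f_def B_def by (rule qbinom_qfact)
  have "f M * (f M * B - 1) = (f (k + m) - f M) - (f k - f M) * (B * f m) - (f m - f M) * (B * f M)"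
    by (simp add: algebra_simps flip: eq)
  also have "fps_X ^ M dvd \<dots>"
    using assms by (intro dvd_diff dvd_mult2 f) auto
  finally have "fps_X ^ M dvd f M * (f M * B - 1)" .
  then have "fps_X ^ M dvd f M * B - 1"
    by (rule fps_X_power_dvd_cancel) (simp add: f_def qfact_fps_X_nth_0 assms)
  moreover have "fps_X ^ M dvd (f N - f M) * B"
    using assms by (intro dvd_mult2 f)
  ultimately have "fps_X ^ M dvd (f N - f M) * B + (f M * B - 1)"
    by (intro dvd_add)
  then show ?thesis
    by (simp add: f_def B_def algebra_simps)
qed

text \<open>The choice N = 2M is even, as the finite identity requires, and leaves room for a middle
  range of indices on which the Gaussian binomials have reached their limit modulo X^M.\<close>

lemma triple_product_cong:
  fixes x :: "'a::idom" and M :: nat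
  assumes "0 < b" "b < a" "x * x = 1"
  defines "N \<equiv> 2 * M"
  shows "fps_X ^ M dvd
      qfact (fps_X ^ a) N * (\<Prod>i<N. (1 + fps_const x * fps_X ^ (a * Suc i - b)) *
        (1 + fps_const x * fps_X ^ (a * i + b))) -
      (\<Sum>k\<le>2 * N. fps_const x ^ k * fps_X ^ nat (theta_exp a b (int N - int k)))"
proof -
  define B where "B k = qfact (fps_X ^ a :: 'a fps) N * qbinom (fps_X ^ a) (2 * N) k - 1" for k
  define e where "e k = nat (theta_exp a b (int N - int k))" for k
  have *: "(\<Prod>i<N. (1 + fps_const x * fps_X ^ (a * Suc i - b)) * (1 + fps_const x * fps_X ^ (a * i + b)))
    = (\<Sum>k\<le>2 * N. qbinom (fps_X ^ a) (2 * N) k * fps_const x ^ k * fps_X ^ e k)"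
    unfolding e_def by (rule finite_triple_product) (use assms in \<open>auto simp: N_def\<close>)
  have "qfact (fps_X ^ a) N * (\<Sum>k\<le>2 * N. qbinom (fps_X ^ a) (2 * N) k * fps_const x ^ k * fps_X ^ e k) -
      (\<Sum>k\<le>2 * N. fps_const x ^ k * fps_X ^ e k) =
      (\<Sum>k\<le>2 * N. B k * fps_const x ^ k * fps_X ^ e k)"
    by (simp add: sum_distrib_left B_def algebra_simps sum_subtractf)
  also have "fps_X ^ M dvd \<dots>"
  proof (rule dvd_sum)
    fix k assume k: "k \<in> {..2 * N}"
    show "fps_X ^ M dvd B k * fps_const x ^ k * fps_X ^ e k"
    \<comment> \<open>In the middle range the coefficient \<open>B k\<close> vanishes modulo X^M;
      outside it |N - k| >= M, so the theta power itself does.\<close>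
    proof (cases "M \<le> k \<and> k + M \<le> 2 * N")
      case True
      then have "M \<le> 2 * N - k"
        by linarith
      with True have "fps_X ^ M dvd B k"
        using qbinom_fps_X_cong[of a M k "2 * N - k" N] k assms(2) by (simp add: B_def N_def)
      then show ?thesis by (simp add: mult.assoc)
    next
      case False
      then have "int M \<le> \<bar>int N - int k\<bar>"
        by (auto simp: N_def)
      also have "\<dots> \<le> theta_exp a b (int N - int k)"
        by (rule theta_exp_ge_abs) (use assms in auto)
      finally have "M \<le> e k" by (simp add: e_def)
      then show ?thesis by (simp add: le_imp_power_dvd)
    qed
  qed
  finally show ?thesis
    unfolding * e_def .
qed

section \<open>The Euler operator and Lambert series\<close>

definition fps_theta :: "'a::comm_ring_1 fps \<Rightarrow> 'a fps" where
  "fps_theta f = fps_X * fps_deriv f"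

lemma fps_theta_nth: "fps_theta f $ n = of_nat n * f $ n"
  by (cases n) (simp_all add: fps_theta_def)

text \<open>Logarithmic derivatives add, by the Leibniz rule. Writing
  \<open>fps_theta f = f * l\<close> for "l is the logarithmic derivative of f" avoids
  division.\<close>

lemma fps_theta_mult_logderiv:
  assumes "fps_theta f = f * l" "fps_theta g = g * m"
  shows "fps_theta (f * g) = f * g * (l + m)"
proof -
  have "fps_theta (f * g) = f * fps_theta g + g * fps_theta f"
    by (simp add: fps_theta_def algebra_simps)
  then show ?thesis
    unfolding assms by (simp add: algebra_simps)
qed

lemma fps_theta_prod_logderiv:
  fixes n :: nat
  assumes "\<And>i. i < n \<Longrightarrow> fps_theta (f i) = f i * l i"
  shows "fps_theta (\<Prod>i<n. f i) = (\<Prod>i<n. f i) * (\<Sum>i<n. l i)"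
  using assms
proof (induction n)
  case 0
  show ?case by (simp add: fps_theta_def)
next
  case (Suc n)
  then show ?case by (simp add: fps_theta_mult_logderiv)
qed

text \<open>The expansion of $q\,\frac{d}{dq} \log (1 + x q^d)$.\<close>

definition lambert :: "'a::comm_ring_1 \<Rightarrow> nat \<Rightarrow> 'a fps" where
  "lambert x d = Abs_fps (\<lambda>n. if 0 < n \<and> d dvd n then - of_nat d * (- x) ^ (n div d) else 0)"

text \<open>At n = d m with m >= 2, two consecutive terms of the geometric progression -d (-x)^m
  cancel on the right; m = 1 leaves exactly d x.\<close>

lemma fps_theta_lambert:
  assumes "0 < d"
  shows "fps_theta (1 + fps_const x * fps_X ^ d) = (1 + fps_const x * fps_X ^ d) * lambert x d"
proof (rule fps_ext)
  fix n
  have R: "((1 + fps_const x * fps_X ^ d) * lambert x d) $ n =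
    lambert x d $ n + x * (if n < d then 0 else lambert x d $ (n - d))"
    by (simp add: distrib_right mult.assoc fps_X_power_mult_nth)
  show "fps_theta (1 + fps_const x * fps_X ^ d) $ n = ((1 + fps_const x * fps_X ^ d) * lambert x d) $ n"
  proof (cases "d dvd n")
    case False
    then have "n \<noteq> d" "n \<noteq> 0" "n \<ge> d \<Longrightarrow> \<not> d dvd n - d"
      by (auto simp: dvd_minus_self intro!: Nat.gr0I)
    with False show ?thesis
      unfolding R by (simp add: fps_theta_nth lambert_def)
  next
    case True
    then obtain m where m: "n = d * m" ..
    consider "m = 0" | "m = 1" | r where "m = Suc (Suc r)"
      by (metis One_nat_def old.nat.exhaust)
    then show ?thesis
    proof cases
      case 3
      then have "d * m - d = d * Suc r" "\<not> d * m < d" "d * m \<noteq> d" "d * m \<noteq> 0"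
        using assms by auto
      then show ?thesis
        unfolding R[unfolded m] m using assms 3 by (simp add: fps_theta_nth lambert_def algebra_simps)
    qed (unfold R, use assms m in \<open>simp_all add: fps_theta_nth lambert_def\<close>)
  qed
qed

text \<open>The logarithmic derivative of the triple product cut off after \<open>N\<close> blocks;
  the parameter -1 belongs to the factors 1 - q^(ai).\<close>

definition triple_lambert :: "nat \<Rightarrow> nat \<Rightarrow> 'a::comm_ring_1 \<Rightarrow> nat \<Rightarrow> 'a fps" where
  "triple_lambert a b x N = (\<Sum>i<N. lambert (-1) (a * Suc i) + lambert x (a * Suc i - b) + lambert x (a * i + b))"

text \<open>This compares coefficient \<open>n\<close> in theta P = P L, where the product P may be
  replaced by the theta series T because both agree up to q^n.\<close>

lemma triple_product_recurrence:
  fixes x :: "'a::idom" and n :: nat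
  assumes "0 < b" "b < a" "x * x = 1"
  defines "N \<equiv> 2 * Suc n"
  shows "(\<Sum>k\<le>2 * N. x ^ k * triple_lambert a b x N $ nat (int n - theta_exp a b (int N - int k))) =
    of_nat n * (\<Sum>k\<le>2 * N. if int n = theta_exp a b (int N - int k) then x ^ k else 0)"
proof -
  define L where "L = triple_lambert a b x N"
  define e where "e k = theta_exp a b (int N - int k)" for k
  define T where "T = (\<Sum>k\<le>2 * N. fps_const x ^ k * fps_X ^ nat (e k))"
  define P where "P = qfact (fps_X ^ a) N * (\<Prod>i<N. (1 + fps_const x * fps_X ^ (a * Suc i - b)) *
        (1 + fps_const x * fps_X ^ (a * i + b)))"
  have e_nonneg: "0 \<le> e k" for k
    unfolding e_def using theta_exp_ge_abs[OF assms(1,2)] by (meson abs_ge_zero order_trans)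
  have P_eq: "P = (\<Prod>i<N. (1 + fps_const (-1) * fps_X ^ (a * Suc i)) *
      (1 + fps_const x * fps_X ^ (a * Suc i - b)) * (1 + fps_const x * fps_X ^ (a * i + b)))"
    unfolding P_def qfact_def
    by (simp add: prod.distrib mult.assoc power_add flip: power_mult fps_const_neg)
  have "fps_X ^ Suc n dvd P - T"
    unfolding P_def T_def e_def N_def by (rule triple_product_cong) fact+
  then obtain r where "P - T = fps_X ^ Suc n * r" ..
  then have "(P - T) $ i = 0" if "i \<le> n" for i
    using that by (simp only: fps_X_power_mult_nth) simp
  then have PT: "P $ i = T $ i" if "i \<le> n" for i
    using that by simp
  have "b < a * Suc i" for i
    using assms by (simp add: trans_less_add1)
  then have "fps_theta P = P * L"
    unfolding P_eq L_def triple_lambert_def using assms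
    by (intro fps_theta_prod_logderiv fps_theta_mult_logderiv fps_theta_lambert) auto
  then have "(P * L) $ n = of_nat n * P $ n"
    by (metis fps_theta_nth)
  then have "(T * L) $ n = of_nat n * T $ n"
    using PT by (simp add: fps_mult_nth)
  moreover have "T $ n = (\<Sum>k\<le>2 * N. if int n = e k then x ^ k else 0)"
    unfolding T_def fps_sum_nth
  proof (intro sum.cong refl)
    fix k
    have "(n = nat (e k)) = (int n = e k)" using e_nonneg[of k] by auto
    then show "(fps_const x ^ k * fps_X ^ nat (e k)) $ n = (if int n = e k then x ^ k else 0)"
      by (simp add: fps_const_power)
  qed
  moreover have "(T * L) $ n = (\<Sum>k\<le>2 * N. x ^ k * L $ nat (int n - e k))"
    unfolding T_def sum_distrib_right fps_sum_nth
  proof (intro sum.cong refl)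
    fix k
    \<comment> \<open>When \<open>e k\<close> exceeds \<open>n\<close>, \<open>nat\<close> clamps
      the index to 0, and this zero coefficient makes the formula right there too.\<close>
    have "L $ 0 = 0"
      by (simp add: L_def triple_lambert_def fps_sum_nth lambert_def)
    moreover have "(n < nat (e k)) = (int n < e k)" "n - nat (e k) = nat (int n - e k)"
      using e_nonneg[of k] by auto
    ultimately show "(fps_const x ^ k * fps_X ^ nat (e k) * L) $ n = x ^ k * L $ nat (int n - e k)"
      by (simp add: fps_const_power mult.assoc fps_X_power_mult_nth)
  qed
  ultimately show ?thesis
    unfolding L_def e_def by simp
qed

subsection \<open>Divisor sums\<close>

lemma sum_interval_dvd:
  fixes f :: "nat \<Rightarrow> 'a::comm_monoid_add"
  assumes "0 < t" "t \<le> K"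
  shows "(\<Sum>d = 1..K. if d dvd t then f d else 0) = (\<Sum>d | d dvd t. f d)"
proof -
  have "{d. d dvd t} = {d \<in> {1..K}. d dvd t}"
    using assms by (auto intro: Suc_leI dvd_pos_nat dest: dvd_imp_le)
  moreover have "(\<Sum>d | d \<in> {1..K} \<and> d dvd t. f d) = (\<Sum>d = 1..K. if d dvd t then f d else 0)"
    by (rule sum.inter_filter) simp
  ultimately show ?thesis
    by simp
qed

text \<open>Each block of three consecutive integers is listed in the order in which
  \<open>triple_lambert 3 2\<close> adds its factors.\<close>

lemma sum_interval_mult_3:
  fixes g :: "nat \<Rightarrow> 'a::comm_monoid_add"
  shows "(\<Sum>d = 1..3 * N. g d) = (\<Sum>i<N. g (3 * Suc i) + g (3 * Suc i - 2) + g (3 * i + 2))"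
proof (induction N)
  case (Suc N)
  have *: "3 * Suc N = Suc (Suc (Suc (3 * N)))" "3 * Suc N - 2 = Suc (3 * N)" "3 * N + 2 = Suc (Suc (3 * N))"
    by auto
  show ?case
    using Suc.IH unfolding sum.lessThan_Suc * by (simp add: add_ac)
qed simp

text \<open>Each d in 1..3N is the exponent of exactly one factor: 1 - q^d if 3 divides d, and 1 + x
  q^d otherwise. The bound t <= N ensures that all divisors of \<open>t\<close> are among
  them.\<close>

lemma triple_lambert_3_2_nth:
  assumes "0 < t" "t \<le> N"
  shows "triple_lambert 3 2 x N $ t =
    (\<Sum>d | d dvd t. - of_nat d * (if 3 dvd d then 1 else (- x) ^ (t div d)))"
proof -
  define g where "g d = (if d dvd t then - of_nat d * (if 3 dvd d then 1 else (- x) ^ (t div d)) else 0)" for d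
  have "triple_lambert 3 2 x N $ t = (\<Sum>i<N. g (3 * Suc i) + g (3 * Suc i - 2) + g (3 * i + 2))"
    unfolding triple_lambert_def fps_sum_nth
  proof (intro sum.cong refl)
    fix i
    have "3 dvd 3 * Suc i" "\<not> 3 dvd 3 * Suc i - 2" "\<not> 3 dvd 3 * i + 2"
      by presburger+
    then show "(lambert (- 1) (3 * Suc i) + lambert x (3 * Suc i - 2) + lambert x (3 * i + 2)) $ t = g (3 * Suc i) + g (3 * Suc i - 2) + g (3 * i + 2)"
      using \<open>0 < t\<close> by (simp add: lambert_def g_def del: mult_Suc_right)
  qed
  also have "\<dots> = (\<Sum>d = 1..3 * N. g d)"
    by (rule sum_interval_mult_3[symmetric])
  finally show ?thesis
    unfolding g_def using assms by (subst (asm) sum_interval_dvd) auto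
qed

lemma sum_interval_mult_4:
  fixes g :: "nat \<Rightarrow> 'a::comm_monoid_add"
  shows "(\<Sum>d = 1..4 * N. g d) = (\<Sum>i<N. g (4 * Suc i) + g (4 * Suc i - 3) + g (4 * i + 3) + g (4 * i + 2))"
proof (induction N)
  case (Suc N)
  have *: "4 * Suc N = Suc (Suc (Suc (Suc (4 * N))))" "4 * Suc N - 3 = Suc (4 * N)" "4 * N + 3 = Suc (Suc (Suc (4 * N)))"
    by auto
  show ?case
    using Suc.IH unfolding sum.lessThan_Suc * by (simp add: add_ac)
qed simp

lemma triple_lambert_4_3_nth:
  assumes "0 < t" "t \<le> N"
  shows "triple_lambert 4 3 x N $ t =
    (\<Sum>d | d dvd t. - of_nat d * (if 4 dvd d then 1 else if odd d then (- x) ^ (t div d) else 0))"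
proof -
  define g where "g d = (if d dvd t then - of_nat d * (if 4 dvd d then 1 else if odd d then (- x) ^ (t div d) else 0) else 0)" for d
  have "triple_lambert 4 3 x N $ t = (\<Sum>i<N. g (4 * Suc i) + g (4 * Suc i - 3) + g (4 * i + 3))"
    unfolding triple_lambert_def fps_sum_nth
  proof (intro sum.cong refl)
    fix i
    have "4 dvd 4 * Suc i" "\<not> 4 dvd 4 * Suc i - 3" "odd (4 * Suc i - 3)" "\<not> 4 dvd 4 * i + 3" "odd (4 * i + 3)"
      by presburger+
    then show "(lambert (- 1) (4 * Suc i) + lambert x (4 * Suc i - 3) + lambert x (4 * i + 3)) $ t = g (4 * Suc i) + g (4 * Suc i - 3) + g (4 * i + 3)"
      using \<open>0 < t\<close> by (simp add: lambert_def g_def del: mult_Suc_right)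
  qed
  also have "\<dots> = (\<Sum>d = 1..4 * N. g d)"
  proof -
    \<comment> \<open>The class 2 modulo 4 contributes no factor to the product, and the weight
      \<open>g\<close> is zero on it.\<close>
    have "\<not> 4 dvd 4 * i + 2" "even (4 * i + 2)" for i :: nat
      by presburger+
    then have "g (4 * i + 2) = 0" for i
      by (simp add: g_def)
    then show ?thesis
      unfolding sum_interval_mult_4 by simp
  qed
  finally show ?thesis
    unfolding g_def using assms by (subst (asm) sum_interval_dvd) auto
qed

lemma sigma_odd_of_nat:
  assumes "0 < t"
  shows "sigma_odd (int t) = (\<Sum>d | d dvd t. if odd d then int d else 0)"
proof -
  have "sigma_odd (int t) = (\<Sum>d | d dvd t \<and> odd d. int d)"
    unfolding sigma_odd_def using assms
    by (auto intro!: sum.reindex_bij_witness[where i = int and j = nat]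
        simp: even_nat_iff nat_dvd_iff)
  also have "\<dots> = (\<Sum>d | d dvd t. if odd d then int d else 0)"
    using sum.inter_filter[of "{d. d dvd t}" int odd] assms by simp
  finally show ?thesis .
qed

text \<open>Halving maps the even divisors of \<open>t\<close> bijectively to the divisors with even
  codivisor.\<close>

lemma sum_even_divisors:
  fixes t :: nat
  assumes "0 < t"
  shows "(\<Sum>d | d dvd t. if even d then int d else 0) =
    2 * (\<Sum>d | d dvd t. if even (t div d) then int d else 0)"
proof -
  have "(\<Sum>d | d dvd t \<and> even d. int d) = (\<Sum>d | d dvd t \<and> even (t div d). 2 * int d)"
    (is "_ = ?R")
    using assms
    by (intro sum.reindex_bij_witness[where i = "\<lambda>d. 2 * d" and j = "\<lambda>d. d div 2"])
      (auto elim!: dvdE)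
  also have "?R = 2 * (\<Sum>d | d dvd t \<and> even (t div d). int d)"
    by (simp only: sum_distrib_left)
  finally show ?thesis
    using sum.inter_filter[of "{d. d dvd t}" int even]
      sum.inter_filter[of "{d. d dvd t}" int "\<lambda>d. even (t div d)"] assms
    by simp
qed

text \<open>The alternating sum is sigma(t) minus twice the divisors with even codivisor, which is
  sigma(t) minus the even divisors.\<close>

lemma sigma_odd_alternating:
  assumes "0 < t"
  shows "sigma_odd (int t) = (\<Sum>d | d dvd t. - int d * (- 1) ^ (t div d))"
proof -
  have "(\<Sum>d | d dvd t. - int d * (- 1) ^ (t div d)) =
    (\<Sum>d | d dvd t. int d - 2 * (if even (t div d) then int d else 0))"
    by (intro sum.cong) (auto simp: minus_one_power_iff)
  also have "\<dots> = (\<Sum>d | d dvd t. int d) - (\<Sum>d | d dvd t. if even d then int d else 0)"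
    using sum_even_divisors[OF assms] by (simp add: sum_subtractf sum_distrib_left)
  also have "\<dots> = (\<Sum>d | d dvd t. if odd d then int d else 0)"
    unfolding sum_subtractf[symmetric] by (intro sum.cong) auto
  finally show ?thesis
    using sigma_odd_of_nat[OF assms] by simp
qed

text \<open>The two divisor sums differ only at d divisible by 3, and there by 0 or 2d, a multiple
  of 6.\<close>

lemma triple_lambert_3_2_pos_cong:
  assumes "0 < t" "t \<le> N"
  shows "[sigma_odd (int t) = triple_lambert 3 2 1 N $ t] (mod 6)"
  unfolding triple_lambert_3_2_nth[OF assms] sigma_odd_alternating[OF assms(1)]
proof (rule cong_sum)
  fix d
  have "6 dvd int d - - int d" if "3 dvd d"
    using that by presburger
  then show "[- int d * (- 1) ^ (t div d) =
      - int d * (if 3 dvd d then 1 else (- 1) ^ (t div d))] (mod 6)"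
    by (auto simp: minus_one_power_iff cong_iff_dvd_diff)
qed

text \<open>Modulo 2 all signs disappear and even divisors contribute nothing.\<close>

lemma triple_lambert_4_3_cong:
  assumes "0 < t" "t \<le> N"
  shows "[sigma_odd (int t) = triple_lambert 4 3 1 N $ t] (mod 2)"
  unfolding triple_lambert_4_3_nth[OF assms] sigma_odd_of_nat[OF assms(1)]
  by (rule cong_sum) (auto simp: minus_one_power_iff cong_iff_dvd_diff)

text \<open>At x = -1 every divisor has weight -1, so the coefficient is -sigma(t). For odd
  \<open>t\<close> this gives equality; for even \<open>t\<close>, sigma(t) = A + 2B with A =
  sigma_odd(t), and the claim is that 4 divides 2(A + B).\<close>

lemma triple_lambert_3_2_neg_cong:
  assumes "0 < t" "t \<le> N"
  shows "[sigma_odd (int t) = (- 1) ^ t * triple_lambert 3 2 (- 1) N $ t] (mod 4)"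
proof -
  have L: "triple_lambert 3 2 (- 1) N $ t = - (\<Sum>d | d dvd t. int d)"
    unfolding triple_lambert_3_2_nth[OF assms] sum_negf[symmetric] by (intro sum.cong) auto
  show ?thesis
  proof (cases "even t")
    case True
    define A where "A = (\<Sum>d | d dvd t. if odd d then int d else 0)"
    define B where "B = (\<Sum>d | d dvd t. if even (t div d) then int d else 0)"
    have "(\<Sum>d | d dvd t. int d) = A + (\<Sum>d | d dvd t. if even d then int d else 0)"
      unfolding A_def sum.distrib[symmetric] by (intro sum.cong) auto
    then have S: "(\<Sum>d | d dvd t. int d) = A + 2 * B"
      unfolding B_def sum_even_divisors[OF assms(1)] .
    \<comment> \<open>In an even \<open>t\<close> each odd divisor has an even codivisor, so
      \<open>A\<close> and \<open>B\<close> contain the same odd terms.\<close>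
    have "[B = A] (mod 2)"
      unfolding A_def B_def
    proof (rule cong_sum)
      fix d assume "d \<in> {d. d dvd t}"
      then have "even (t div d)" if "odd d"
        using that True by (metis dvd_mult_div_cancel even_mult_iff mem_Collect_eq)
      then show "[if even (t div d) then int d else 0 = (if odd d then int d else 0)] (mod 2)"
        by (auto simp: cong_iff_dvd_diff)
    qed
    then have "4 dvd A - - (A + 2 * B)"
      by (simp add: cong_iff_dvd_diff) presburger
    then show ?thesis
      using True unfolding L S sigma_odd_of_nat[OF assms(1)] A_def[symmetric]
      by (simp add: cong_iff_dvd_diff)
  next
    case False
    then have "odd d" if "d dvd t" for d
      using that dvd_trans by blast
    then have "sigma_odd (int t) = (\<Sum>d | d dvd t. int d)"
      unfolding sigma_odd_of_nat[OF assms(1)] by (intro sum.cong) auto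
    with False show ?thesis
      by (simp add: L)
  qed
qed

section \<open>Generalized pentagonal and hexagonal numbers, and sums over all integers\<close>

lemma gpolygonal_double: "2 * gpolygonal m k = (int m - 2) * k\<^sup>2 - (int m - 4) * k"
  unfolding gpolygonal_def by simp

lemma gpolygonal_5_theta_exp: "gpolygonal 5 j = theta_exp 3 2 j"
  using gpolygonal_double[of 5 j] theta_exp_double[of 3 2 j]
  by (simp add: power2_eq_square algebra_simps)

lemma gpolygonal_6_theta_exp: "gpolygonal 6 j = theta_exp 4 3 j"
  using gpolygonal_double[of 6 j] theta_exp_double[of 4 3 j]
  by (simp add: power2_eq_square algebra_simps)

lemma inj_gpolygonal_6: "inj (gpolygonal 6)"
proof (rule injI)
  fix j k :: int
  assume "gpolygonal 6 j = gpolygonal 6 k"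
  then have "(j - k) * (4 * (j + k) - 2) = 0"
    using gpolygonal_double[of 6 j] gpolygonal_double[of 6 k]
    by (simp add: power2_eq_square algebra_simps)
  moreover have "4 * (j + k) - 2 \<noteq> 0"
    by presburger
  ultimately show "j = k"
    by simp
qed

lemma gpolygonal_5_ge_abs: "\<bar>j\<bar> \<le> gpolygonal 5 j"
  and gpolygonal_6_ge_abs: "\<bar>j\<bar> \<le> gpolygonal 6 j"
  unfolding gpolygonal_5_theta_exp gpolygonal_6_theta_exp by (rule theta_exp_ge_abs; simp)+

lemma infsum_finite_support:
  fixes f :: "'a \<Rightarrow> 'b::{comm_monoid_add,t2_space}"
  assumes "finite A" "\<And>k. k \<notin> A \<Longrightarrow> f k = 0"
  shows "f summable_on UNIV" "infsum f UNIV = sum f A"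
proof -
  have "(f has_sum sum f A) UNIV"
    using assms by (intro has_sum_finite_neutralI) auto
  then show "f summable_on UNIV" "infsum f UNIV = sum f A"
    by (auto simp: summable_on_def dest: infsumI)
qed

text \<open>The singleton of the limit is open, so all finite partial sums beyond some F equal it;
  adjoining an index outside F then cannot change the sum.\<close>

lemma summable_on_discrete_imp_finite_support:
  fixes f :: "'a \<Rightarrow> 'b::{ab_group_add,discrete_topology}"
  assumes "f summable_on A"
  shows "finite {k \<in> A. f k \<noteq> 0}"
proof -
  obtain s where "(f has_sum s) A"
    using assms by (auto simp: summable_on_def)
  then have "eventually (\<lambda>F. sum f F \<in> {s}) (finite_subsets_at_top A)"
    unfolding has_sum_def by (rule topological_tendstoD) (auto simp: open_discrete)
  then obtain F where F: "finite F" "F \<subseteq> A"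
    and sum_eq: "\<And>G. finite G \<Longrightarrow> F \<subseteq> G \<Longrightarrow> G \<subseteq> A \<Longrightarrow> sum f G = s"
    unfolding eventually_finite_subsets_at_top by auto
  have "k \<in> F" if "k \<in> A" "f k \<noteq> 0" for k
  proof (rule ccontr)
    assume "k \<notin> F"
    then have "sum f (insert k F) = f k + sum f F"
      using F by simp
    with sum_eq[of F] sum_eq[of "insert k F"] F that show False
      by auto
  qed
  then show ?thesis
    by (intro finite_subset[OF _ F(1)]) auto
qed

text \<open>The substitution j = N - k makes the recurrence symmetric in \<open>j\<close>; since
  \<open>N\<close> is even and x is 1 or -1, x^k = x^|j|.\<close>

lemma theta_recurrence:
  fixes n :: int and x :: int
  assumes "0 < b" "b < a" "x * x = 1" "0 < n"
  defines "N \<equiv> 2 * Suc (nat n)"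
  shows "(\<Sum>j\<in>{- int N..int N}. x ^ nat \<bar>j\<bar> * triple_lambert a b x N $ nat (n - theta_exp a b j)) =
    n * (\<Sum>j\<in>{- int N..int N}. if n = theta_exp a b j then x ^ nat \<bar>j\<bar> else 0)"
proof -
  have shift: "(\<Sum>j\<in>{- int N..int N}. g j) = (\<Sum>k\<le>2 * N. g (int N - int k))" for g :: "int \<Rightarrow> int"
    by (rule sum.reindex_bij_witness[where i = "\<lambda>k. int N - int k" and j = "\<lambda>j. nat (int N - j)"]) auto
  have "x = 1 \<or> x = - 1"
    using assms(3) by (metis power2_eq_square power2_eq_1_iff)
  then have pow: "x ^ nat \<bar>int N - int k\<bar> = x ^ k" for k
    by (auto simp: minus_one_power_iff even_nat_iff N_def)
  show ?thesis
    unfolding shift pow using triple_product_recurrence[OF assms(1-3), of "nat n"] \<open>0 < n\<close>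
    by (simp add: N_def)
qed

subsection \<open>The congruences\<close>

lemma sum_if_unique_solution:
  fixes P :: "int \<Rightarrow> int" and w :: "int \<Rightarrow> 'a::comm_monoid_add"
  assumes "inj P" "\<And>j. \<bar>j\<bar> \<le> P j" "P i \<le> K"
  shows "(\<Sum>j\<in>{- K..K}. if P i = P j then w j else 0) = w i"
proof -
  have "P i = P j \<longleftrightarrow> i = j" for j
    using assms(1) by (auto dest: injD)
  moreover have "i \<in> {- K..K}"
    using assms(2)[of i] assms(3) by auto
  ultimately show ?thesis
    by simp
qed

lemma sigma_odd_nonpos: "n \<le> 0 \<Longrightarrow> sigma_odd n = 0"
  by (simp add: sigma_odd_def)

text \<open>For |k| > K >= n the argument n - P k is negative. The weight \<open>w\<close> covers
  both the plain and the signed sums.\<close>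

lemma infsum_sigma_odd:
  fixes P w :: "int \<Rightarrow> int"
  assumes "\<And>j. \<bar>j\<bar> \<le> P j" "n \<le> K"
  shows "(\<lambda>k. w k * sigma_odd (n - P k)) summable_on UNIV"
    "(\<Sum>\<^sub>\<infinity>k. w k * sigma_odd (n - P k)) = (\<Sum>k\<in>{- K..K}. w k * sigma_odd (n - P k))"
proof -
  have *: "w k * sigma_odd (n - P k) = 0" if "k \<notin> {- K..K}" for k
  proof -
    have "K < \<bar>k\<bar>" using that by auto
    then have "n - P k \<le> 0" using assms(1)[of k] assms(2) by linarith
    then show ?thesis by (simp add: sigma_odd_nonpos)
  qed
  show "(\<lambda>k. w k * sigma_odd (n - P k)) summable_on UNIV"
    "(\<Sum>\<^sub>\<infinity>k. w k * sigma_odd (n - P k)) = (\<Sum>k\<in>{- K..K}. w k * sigma_odd (n - P k))"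
    by (rule infsum_finite_support[OF finite_atLeastAtMost_int *], assumption)+
qed

lemma triple_lambert_nth_0: "triple_lambert a b x N $ 0 = 0"
  by (simp add: triple_lambert_def fps_sum_nth lambert_def)

text \<open>Each divisor sum is replaced by the congruent Lambert coefficient, after which the
  recurrence at x = 1 evaluates the total exactly.\<close>

lemma infsum_sigma_odd_cong:
  fixes P :: "int \<Rightarrow> int" and m n :: int
  assumes P: "\<And>j. P j = theta_exp a b j" "0 < b" "b < a" "inj P"
    and L: "\<And>t N. 0 < t \<Longrightarrow> t \<le> N \<Longrightarrow> [sigma_odd (int t) = triple_lambert a b 1 N $ t] (mod m)"
    and "0 < n"
  shows "(\<lambda>k. sigma_odd (n - P k)) summable_on UNIV"
    "[(\<Sum>\<^sub>\<infinity>k. sigma_odd (n - P k)) = (if \<exists>j. n = P j then n else 0)] (mod m)"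
proof -
  define N where "N = 2 * Suc (nat n)"
  have ge: "\<bar>j\<bar> \<le> P j" for j
    using P theta_exp_ge_abs by simp
  have nN: "n \<le> int N"
    by (simp add: N_def)
  note inf = infsum_sigma_odd[where w = "\<lambda>_. 1", simplified, OF ge nN]
  show "(\<lambda>k. sigma_odd (n - P k)) summable_on UNIV"
    by (rule inf)
  have "[(\<Sum>\<^sub>\<infinity>k. sigma_odd (n - P k)) = (\<Sum>j\<in>{- int N..int N}. triple_lambert a b 1 N $ nat (n - P j))] (mod m)"
    unfolding inf
  proof (rule cong_sum)
    fix j
    show "[sigma_odd (n - P j) = triple_lambert a b 1 N $ nat (n - P j)] (mod m)"
    proof (cases "n - P j > 0")
      case True
      then have "nat (n - P j) \<le> N" using ge[of j] nN by simp
      with True L[of "nat (n - P j)" N] show ?thesis by simp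
    \<comment> \<open>For n <= P j both sides are 0: \<open>nat\<close> turns the index into 0,
      where the Lambert series vanishes.\<close>
    qed (simp add: sigma_odd_nonpos triple_lambert_nth_0)
  qed
  also have "(\<Sum>j\<in>{- int N..int N}. triple_lambert a b 1 N $ nat (n - P j)) =
      n * (\<Sum>j\<in>{- int N..int N}. if n = P j then 1 else 0)"
    using theta_recurrence[of b a 1 n, unfolded power_one mult_1_left] assms by (simp add: N_def)
  also have "\<dots> = (if \<exists>j. n = P j then n else 0)"
  proof (cases "\<exists>j. n = P j")
    case True
    then obtain i where i: "n = P i" ..
    have "(\<Sum>j\<in>{- int N..int N}. if n = P j then 1 else 0) = (1::int)"
      unfolding i by (rule sum_if_unique_solution[OF P(4) ge]) (use nN i in simp)
    with True show ?thesis by simp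
  qed simp
  finally show "[(\<Sum>\<^sub>\<infinity>k. sigma_odd (n - P k)) = (if \<exists>j. n = P j then n else 0)] (mod m)" .
qed

lemma pent_cong_6:
  assumes "0 < n"
  shows "pent_cong 6 n"
  unfolding pent_cong_def
  using infsum_sigma_odd_cong[of "gpolygonal 5" 3 2 6, OF gpolygonal_5_theta_exp _ _ inj_gpolygonal_5
    triple_lambert_3_2_pos_cong assms]
  by simp

lemma pent_cong_dvd: "pent_cong m n \<Longrightarrow> l dvd m \<Longrightarrow> pent_cong l n"
  unfolding pent_cong_def by (meson cong_dvd_modulus int_dvd_int_iff)

lemma gonal_cong_5: "0 < n \<Longrightarrow> gonal_cong 5 n"
  using pent_cong_dvd[OF pent_cong_6, of n 2] by (simp add: pent_cong_def gonal_cong_def)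

lemma gonal_cong_6:
  assumes "0 < n"
  shows "gonal_cong 6 n"
  unfolding gonal_cong_def
  using infsum_sigma_odd_cong[of "gpolygonal 6" 4 3 2, OF gpolygonal_6_theta_exp _ _ inj_gpolygonal_6
    triple_lambert_4_3_cong assms]
  by simp

text \<open>This holds because $P_5(j) = P_3(-j) + j^2$.\<close>

lemma tri_sign_eq: "tri_sign j = (- 1) ^ nat (gpolygonal 5 j) * (- 1) ^ nat \<bar>j\<bar>"
proof -
  have "gpolygonal 5 j = gpolygonal 3 (- j) + j\<^sup>2"
    using gpolygonal_double[of 5 j] gpolygonal_double[of 3 "- j"] by simp
  moreover have "0 \<le> gpolygonal 5 j"
    using gpolygonal_5_ge_abs[of j] by linarith
  ultimately show ?thesis
    using gpolygonal_3_nonneg[of "- j"]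
    by (auto simp: tri_sign_def minus_one_power_iff even_nat_iff)
qed

text \<open>With t = n - P_5(j), the sign tri_sign(j) (-1)^t equals (-1)^n (-1)^|j|. The global
  factor (-1)^n comes out, and what remains is the recurrence at x = -1.\<close>

lemma signed_pent_sum:
  assumes "0 < n"
  shows "(\<lambda>k. tri_sign k * sigma_odd (n - gpolygonal 5 k)) summable_on UNIV"
    "n = gpolygonal 5 i \<Longrightarrow>
      [(\<Sum>\<^sub>\<infinity>k. tri_sign k * sigma_odd (n - gpolygonal 5 k)) = tri_sign i * n] (mod 4)"
    "\<nexists>j. n = gpolygonal 5 j \<Longrightarrow>
      [(\<Sum>\<^sub>\<infinity>k. tri_sign k * sigma_odd (n - gpolygonal 5 k)) = 0] (mod 4)"
proof -
  define N where "N = 2 * Suc (nat n)"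
  define L where "L = triple_lambert 3 2 (- 1 :: int) N"
  define T where "T = (\<Sum>j\<in>{- int N..int N}. if n = gpolygonal 5 j then (- 1) ^ nat \<bar>j\<bar> else 0 :: int)"
  have nN: "n \<le> int N"
    by (simp add: N_def)
  note inf = infsum_sigma_odd[OF gpolygonal_5_ge_abs nN, of tri_sign]
  show "(\<lambda>k. tri_sign k * sigma_odd (n - gpolygonal 5 k)) summable_on UNIV"
    by (rule inf)
  have "[(\<Sum>\<^sub>\<infinity>k. tri_sign k * sigma_odd (n - gpolygonal 5 k)) =
      (\<Sum>j\<in>{- int N..int N}. (- 1) ^ nat n * ((- 1) ^ nat \<bar>j\<bar> * L $ nat (n - gpolygonal 5 j)))] (mod 4)"
    unfolding inf
  proof (rule cong_sum)
    fix j
    show "[tri_sign j * sigma_odd (n - gpolygonal 5 j) =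
      (- 1) ^ nat n * ((- 1) ^ nat \<bar>j\<bar> * L $ nat (n - gpolygonal 5 j))] (mod 4)"
    proof (cases "n - gpolygonal 5 j > 0")
      case True
      define t where "t = nat (n - gpolygonal 5 j)"
      have P: "0 \<le> gpolygonal 5 j"
        using gpolygonal_5_ge_abs[of j] by linarith
      have t: "n - gpolygonal 5 j = int t" "0 < t" "t \<le> N"
        using True P nN by (simp_all add: t_def)
      have "nat n = nat (gpolygonal 5 j) + t"
        using True P by (simp add: t_def)
      then have eq: "(- 1) ^ nat n * ((- 1) ^ nat \<bar>j\<bar> * L $ nat (n - gpolygonal 5 j)) =
          tri_sign j * ((- 1) ^ t * L $ t)"
        by (simp add: tri_sign_eq power_add t)
      have "[sigma_odd (int t) = (- 1) ^ t * L $ t] (mod 4)"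
        unfolding L_def by (rule triple_lambert_3_2_neg_cong) fact+
      then show ?thesis
        unfolding eq by (subst t(1)) (rule cong_scalar_left)
    qed (simp add: sigma_odd_nonpos triple_lambert_nth_0 L_def)
  qed
  also have "(\<Sum>j\<in>{- int N..int N}. (- 1) ^ nat n * ((- 1) ^ nat \<bar>j\<bar> * L $ nat (n - gpolygonal 5 j))) =
      (- 1) ^ nat n * (n * T)"
    using theta_recurrence[of 2 3 "- 1" n] assms
    by (simp add: N_def L_def T_def gpolygonal_5_theta_exp flip: sum_distrib_left)
  finally have *: "[(\<Sum>\<^sub>\<infinity>k. tri_sign k * sigma_odd (n - gpolygonal 5 k)) = (- 1) ^ nat n * (n * T)] (mod 4)" .
  show "[(\<Sum>\<^sub>\<infinity>k. tri_sign k * sigma_odd (n - gpolygonal 5 k)) = tri_sign i * n] (mod 4)"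
    if i: "n = gpolygonal 5 i"
  proof -
    have "T = (- 1) ^ nat \<bar>i\<bar>"
      unfolding T_def i
      by (rule sum_if_unique_solution) (use nN i in \<open>auto simp: inj_gpolygonal_5 gpolygonal_5_ge_abs\<close>)
    \<comment> \<open>The same sign identity at j = i, where t = 0.\<close>
    then have "(- 1) ^ nat n * (n * T) = tri_sign i * n"
      by (simp add: tri_sign_eq i mult_ac)
    with * show ?thesis by simp
  qed
  show "[(\<Sum>\<^sub>\<infinity>k. tri_sign k * sigma_odd (n - gpolygonal 5 k)) = 0] (mod 4)"
    if "\<nexists>j. n = gpolygonal 5 j"
  proof -
    have "T = 0" using that by (simp add: T_def)
    with * show ?thesis by simp
  qed
qed

lemma signed_pent_cong_4: "0 < n \<Longrightarrow> signed_pent_cong 4 n"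
  unfolding signed_pent_cong_def of_nat_numeral by (intro conjI allI impI; rule signed_pent_sum)

lemma signed_pent_cong_dvd:
  assumes "signed_pent_cong m n" "l dvd m"
  shows "signed_pent_cong l n"
proof -
  have "int l dvd int m"
    using assms(2) by simp
  note cong_dvd_modulus[OF _ this]
  with assms(1) show ?thesis
    unfolding signed_pent_cong_def by blast
qed

section \<open>Small \<open>n\<close> that exclude all other values of \<open>m\<close>\<close>

lemma sigma_odd_1 [simp]: "sigma_odd 1 = 1"
  and sigma_odd_2 [simp]: "sigma_odd 2 = 1"
  and sigma_odd_3 [simp]: "sigma_odd 3 = 4"
proof -
  have le: "d \<le> n" if "d dvd n" "0 < n" for d n :: int
    using that by (rule zdvd_imp_le)
  have "{d::int. d > 0 \<and> d dvd 1 \<and> odd d} = {1}"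
    by auto
  moreover have "{d::int. d > 0 \<and> d dvd 2 \<and> odd d} = {1}"
  proof -
    have "d = 1" if "d > 0" "d dvd 2" "odd d" for d :: int
    proof -
      have "d = 1 \<or> d = 2" using le[OF that(2)] that(1) by auto
      with that show ?thesis by auto
    qed
    then show ?thesis by auto
  qed
  moreover have "{d::int. d > 0 \<and> d dvd 3 \<and> odd d} = {1, 3}"
  proof -
    have "d = 1 \<or> d = 3" if "d > 0" "d dvd 3" "odd d" for d :: int
    proof -
      have "d = 1 \<or> d = 2 \<or> d = 3" using le[OF that(2)] that(1) by auto
      with that show ?thesis by auto
    qed
    then show ?thesis by auto
  qed
  ultimately show "sigma_odd 1 = 1" "sigma_odd 2 = 1" "sigma_odd 3 = 4"
    by (simp_all add: sigma_odd_def)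
qed

lemma sigma_odd_pos:
  assumes "0 < n"
  shows "0 < sigma_odd n"
proof -
  have "finite {d. 0 < d \<and> d dvd n \<and> odd d}"
    by (rule finite_subset[of _ "{0..n}"]) (use assms in \<open>auto dest: zdvd_imp_le\<close>)
  then have "1 \<le> (\<Sum>d | 0 < d \<and> d dvd n \<and> odd d. d)"
    by (intro member_le_sum[of 1 _ "\<lambda>d. d", simplified]) auto
  with assms show ?thesis
    by (simp add: sigma_odd_def)
qed

text \<open>As P_1(k) = (3k - k^2)/2 and P_2(k) = k, every k <= 0 gives a positive term, so the sum
  diverges.\<close>

lemma not_gonal_cong_1_2:
  assumes "m \<in> {1, 2}"
  shows "\<not> gonal_cong m 1"
proof
  assume "gonal_cong m 1"
  then have "finite {k. sigma_odd (1 - gpolygonal m k) \<noteq> 0}"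
    using summable_on_discrete_imp_finite_support[of "\<lambda>k. sigma_odd (1 - gpolygonal m k)" UNIV]
    by (simp add: gonal_cong_def)
  moreover have "{..0} \<subseteq> {k. sigma_odd (1 - gpolygonal m k) \<noteq> 0}"
  proof
    fix k :: int assume "k \<in> {..0}"
    then have "gpolygonal m k \<le> 0"
    proof (cases "m = 1")
      case True
      have "2 * gpolygonal m k = 3 * k - k\<^sup>2"
        using gpolygonal_double[of m k] True by simp
      then show ?thesis
        using \<open>k \<in> {..0}\<close> zero_le_power2[of k] unfolding atMost_iff by linarith
    next
      case False
      then show ?thesis
        using gpolygonal_double[of m k] \<open>k \<in> {..0}\<close> assms by simp
    qed
    then show "k \<in> {k. sigma_odd (1 - gpolygonal m k) \<noteq> 0}"
      using sigma_odd_pos[of "1 - gpolygonal m k"] by simp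
  qed
  ultimately show False
    using infinite_Iic[of "0::int"] by (meson finite_subset)
qed

text \<open>P_3 is 0 at both k = -1 and k = 0, so the sum is 2, while 1 = P_3(1) calls for an odd
  value.\<close>

lemma not_gonal_cong_3: "\<not> gonal_cong 3 1"
proof -
  have "sigma_odd (1 - gpolygonal 3 k) = 0" if "k \<notin> {-1, 0}" for k
  proof -
    have "0 < k * (k + 1)"
      using that by (cases "k > 0") (auto intro: mult_neg_neg)
    then have "1 \<le> gpolygonal 3 k"
      using gpolygonal_double[of 3 k] by (simp add: power2_eq_square algebra_simps)
    then show ?thesis by (simp add: sigma_odd_nonpos)
  qed
  then have "(\<Sum>\<^sub>\<infinity>k. sigma_odd (1 - gpolygonal 3 k)) = (\<Sum>k\<in>{-1, 0}. sigma_odd (1 - gpolygonal 3 k))"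
    by (intro infsum_finite_support) auto
  also have "\<dots> = 2"
    by (simp add: gpolygonal_def)
  finally have "(\<Sum>\<^sub>\<infinity>k. sigma_odd (1 - gpolygonal 3 k)) = 2" .
  moreover have "1 = gpolygonal 3 1"
    by (simp add: gpolygonal_def)
  ultimately show ?thesis
    unfolding gonal_cong_def by (auto simp: cong_def)
qed

text \<open>The squares 0, 1, 1 give the odd sum 1 + 1 + 1, but 2 is not a square.\<close>

lemma not_gonal_cong_4: "\<not> gonal_cong 4 2"
proof -
  have P: "gpolygonal 4 k = k\<^sup>2" for k
    by (simp add: gpolygonal_def)
  have ge: "4 \<le> k\<^sup>2" if "k \<notin> {-1, 0, 1}" for k :: int
  proof -
    have "2 \<le> \<bar>k\<bar>" using that by auto
    then have "2\<^sup>2 \<le> \<bar>k\<bar>\<^sup>2" by (rule power_mono) simp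
    then show ?thesis by simp
  qed
  have "sigma_odd (2 - k\<^sup>2) = 0" if "k \<notin> {-1, 0, 1}" for k
    using ge[OF that] by (simp add: sigma_odd_nonpos)
  then have "(\<Sum>\<^sub>\<infinity>k. sigma_odd (2 - k\<^sup>2)) = (\<Sum>k\<in>{-1, 0, 1}. sigma_odd (2 - k\<^sup>2))"
    by (intro infsum_finite_support) auto
  also have "\<dots> = 3"
    by simp
  finally have "(\<Sum>\<^sub>\<infinity>k. sigma_odd (2 - k\<^sup>2)) = 3" .
  moreover have "\<nexists>j. 2 = (j::int)\<^sup>2"
  proof
    assume "\<exists>j. 2 = (j::int)\<^sup>2"
    then obtain j :: int where "2 = j\<^sup>2" ..
    with ge[of j] show False by (cases "j \<in> {-1, 0, 1}") auto
  qed
  ultimately show ?thesis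
    unfolding gonal_cong_def P by (auto simp: cong_def)
qed

text \<open>Only P_m(0) = 0 and P_m(1) = 1 lie below 4, so the sum is 4 + 1 = 5, and 3 is not a
  value of P_m.\<close>

lemma not_gonal_cong_ge_7:
  assumes "7 \<le> m"
  shows "\<not> gonal_cong m 3"
proof -
  have P01: "gpolygonal m 0 = 0" "gpolygonal m 1 = 1"
    by (simp_all add: gpolygonal_def)
  have ge: "4 \<le> gpolygonal m k" if "k \<notin> {0, 1}" for k
  proof -
    have "2 \<le> k * (k - 1)"
    proof (cases "k < 0")
      case True
      then have "1 * 2 \<le> (- k) * (1 - k)" by (intro mult_mono) auto
      then show ?thesis by (simp add: algebra_simps)
    next
      case False
      with that have "2 * 1 \<le> k * (k - 1)" by (intro mult_mono) auto
      then show ?thesis by simp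
    qed
    then have "3 * 2 \<le> (int m - 4) * (k * (k - 1))"
      using assms by (intro mult_mono) auto
    moreover have "0 < k\<^sup>2"
      using that by simp
    moreover have "2 * gpolygonal m k = (int m - 4) * (k * (k - 1)) + 2 * k\<^sup>2"
      unfolding gpolygonal_double by (simp add: power2_eq_square algebra_simps)
    ultimately show ?thesis
      by linarith
  qed
  then have "sigma_odd (3 - gpolygonal m k) = 0" if "k \<notin> {0, 1}" for k
    using that by (force intro: sigma_odd_nonpos)
  then have "(\<Sum>\<^sub>\<infinity>k. sigma_odd (3 - gpolygonal m k)) = (\<Sum>k\<in>{0, 1}. sigma_odd (3 - gpolygonal m k))"
    by (intro infsum_finite_support) auto
  also have "\<dots> = 5"
    by (simp add: P01)
  finally have "(\<Sum>\<^sub>\<infinity>k. sigma_odd (3 - gpolygonal m k)) = 5" .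
  moreover have "3 \<noteq> gpolygonal m j" for j
    using ge[of j] P01 by (cases "j \<in> {0, 1}") auto
  ultimately show ?thesis
    unfolding gonal_cong_def by (auto simp: cong_def)
qed

text \<open>The values 0, 1, 2 of P_5 give the sum 4 + 1 + 1 = 6, and 3 is not a value of
  P_5.\<close>

lemma pent_cong_3_imp_dvd:
  assumes "pent_cong m 3"
  shows "m dvd 6"
proof -
  have ivl: "{- 3..3} = {-3, -2, -1, 0, 1, 2, 3::int}"
    by auto
  have "(\<Sum>\<^sub>\<infinity>k. sigma_odd (3 - gpolygonal 5 k)) = (\<Sum>k\<in>{- 3..3}. sigma_odd (3 - gpolygonal 5 k))"
    using infsum_sigma_odd(2)[OF gpolygonal_5_ge_abs, of 3 3 "\<lambda>_. 1"] by simp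
  also have "\<dots> = 6"
    unfolding ivl by (simp add: gpolygonal_def sigma_odd_nonpos)
  finally have "(\<Sum>\<^sub>\<infinity>k. sigma_odd (3 - gpolygonal 5 k)) = 6" .
  moreover have "3 \<noteq> gpolygonal 5 j" for j
  proof
    assume j: "3 = gpolygonal 5 j"
    then have "j \<in> {- 3..3}" using gpolygonal_5_ge_abs[of j] by auto
    with j show False unfolding ivl by (auto simp: gpolygonal_def)
  qed
  ultimately have "int m dvd int 6"
    using assms by (simp add: pent_cong_def cong_0_iff)
  then show ?thesis
    by (simp only: int_dvd_int_iff)
qed

text \<open>Here k = 0 and k = 1 give 1 + 1 = 2, whereas 2 = P_5(-1) carries the sign -1 and demands
  -2; the difference is 4.\<close>

lemma signed_pent_cong_2_imp_dvd:
  assumes "signed_pent_cong m 2"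
  shows "m dvd 4"
proof -
  have ivl: "{- 2..2} = {-2, -1, 0, 1, 2::int}"
    by auto
  have "(\<Sum>\<^sub>\<infinity>k. tri_sign k * sigma_odd (2 - gpolygonal 5 k)) =
      (\<Sum>k\<in>{- 2..2}. tri_sign k * sigma_odd (2 - gpolygonal 5 k))"
    using gpolygonal_5_ge_abs by (rule infsum_sigma_odd) simp
  also have "\<dots> = 2"
    unfolding ivl by (simp add: gpolygonal_def sigma_odd_nonpos tri_sign_def)
  finally have "(\<Sum>\<^sub>\<infinity>k. tri_sign k * sigma_odd (2 - gpolygonal 5 k)) = 2" .
  moreover have "2 = gpolygonal 5 (- 1)" "tri_sign (- 1) = - 1"
    by (simp_all add: gpolygonal_def tri_sign_def)
  ultimately have "[2 = - 1 * 2] (mod int m)"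
    using assms unfolding signed_pent_cong_def by metis
  then have "int m dvd int 4"
    by (simp add: cong_iff_dvd_diff)
  then show ?thesis
    by (simp only: int_dvd_int_iff)
qed

theorem theorem0p0p1:
  shows "(\<forall>m::nat\<ge>1. (\<forall>n::int>0. gonal_cong m n) \<longleftrightarrow> m \<in> {5, 6}) \<and>
         (\<forall>m::nat\<ge>2. (\<forall>n::int>0. pent_cong m n) \<longleftrightarrow> m \<in> {2, 3, 6}) \<and>
         (\<forall>m::nat\<ge>2. (\<forall>n::int>0. signed_pent_cong m n) \<longleftrightarrow> m \<in> {2, 4})"
proof (intro conjI allI impI)
  fix m :: nat assume m: "1 \<le> m"
  show "(\<forall>n>0. gonal_cong m n) \<longleftrightarrow> m \<in> {5, 6}"
  proof
    assume g: "\<forall>n>0. gonal_cong m n"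
    show "m \<in> {5, 6}"
    proof (rule ccontr)
      assume "m \<notin> {5, 6}"
      with m consider "m \<in> {1, 2}" | "m = 3" | "m = 4" | "7 \<le> m" by force
      then show False
        using g not_gonal_cong_1_2 not_gonal_cong_3 not_gonal_cong_4 not_gonal_cong_ge_7
        by cases force+
    qed
  qed (use gonal_cong_5 gonal_cong_6 in auto)
next
  fix m :: nat assume m: "2 \<le> m"
  show "(\<forall>n>0. pent_cong m n) \<longleftrightarrow> m \<in> {2, 3, 6}"
  proof
    assume "\<forall>n>0. pent_cong m n"
    then have dvd: "m dvd 6" by (simp add: pent_cong_3_imp_dvd)
    then have "m \<le> 6" by (rule dvd_imp_le) simp
    with m have "m = 2 \<or> m = 3 \<or> m = 4 \<or> m = 5 \<or> m = 6" by auto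
    with dvd show "m \<in> {2, 3, 6}" by auto
  next
    assume "m \<in> {2, 3, 6}"
    then have "m dvd 6" by auto
    then show "\<forall>n>0. pent_cong m n" using pent_cong_6 pent_cong_dvd by blast
  qed
next
  fix m :: nat assume m: "2 \<le> m"
  show "(\<forall>n>0. signed_pent_cong m n) \<longleftrightarrow> m \<in> {2, 4}"
  proof
    assume "\<forall>n>0. signed_pent_cong m n"
    then have dvd: "m dvd 4" by (simp add: signed_pent_cong_2_imp_dvd)
    then have "m \<le> 4" by (rule dvd_imp_le) simp
    with m have "m = 2 \<or> m = 3 \<or> m = 4" by auto
    with dvd show "m \<in> {2, 4}" by auto
  next
    assume "m \<in> {2, 4}"
    then have "m dvd 4" by auto
    then show "\<forall>n>0. signed_pent_cong m n" using signed_pent_cong_4 signed_pent_cong_dvd by blast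
  qed
qed

end
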